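(* Let $n\ge4$ be even and let $\mathfrak g\cong\mathfrak{so}(2n,\mathbb C)$ be the Lie algebra of complex $2n\times2n$ matrices $$Z=\begin{pmatrix} A & B \\ C & -\tilde A \end{pmatrix},\qquad B=-\tilde B,\quad C=-\tilde C,$$ with $n\times n$ blocks, where $\tilde X=JX^TJ$. Let $\lambda_n$ be the involution $$\lambda_n(Z)=\begin{pmatrix} -\tilde A & C \\ B & A \end{pmatrix},$$ and let $\mathfrak g=\mathfrak g_0\oplus\mathfrak g_1$ be its decomposition into $+1$ and $-1$ eigenspaces. Then $$\mathfrak g_0=\Bigl\{\begin{pmatrix} X & Y \\ Y & X \end{pmatrix}:\tilde X=-X,\ \tilde Y=-Y\Bigr\},\qquad \mathfrak g_1=\Bigl\{\begin{pmatrix} X & Y \\ -Y & -X \end{pmatrix}:\tilde X=X,\ \tilde Y=-Y\Bigr\},$$ and $\mathfrak g_0=\tilde{\mathfrak g}_0\oplus V$, where $\tilde{\mathfrak g}_0$ is the part of $\mathfrak g_0$ with $Y=0$ and $V$ the part with $X=0$; moreover $\tilde{\mathfrak g}_0$ is a Lie subalgebra isomorphic to $\mathfrak{so}(n,\mathbb C)$ (type $D_{n/2}$).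
   Context: $J$ is the $n\times n$ anti-diagonal matrix with all anti-diagonal entries equal to $1$. *)

theory Defs
  imports Complex_Main "Jordan_Normal_Form.Matrix"
begin

definition mat_subspace :: "nat \<Rightarrow> complex mat set \<Rightarrow> bool" where
  "mat_subspace k S \<longleftrightarrow>
     S \<subseteq> carrier_mat k k \<and> 0\<^sub>m k k \<in> S \<and>
     (\<forall>X\<in>S. \<forall>Y\<in>S. X + Y \<in> S) \<and>
     (\<forall>c. \<forall>X\<in>S. c \<cdot>\<^sub>m X \<in> S)"

definition direct_sum :: "nat \<Rightarrow> complex mat set \<Rightarrow> complex mat set \<Rightarrow> complex mat set \<Rightarrow> bool" where
  "direct_sum k W U V \<longleftrightarrow>
     mat_subspace k U \<and> mat_subspace k V \<and>
     W = {X + Y | X Y. X \<in> U \<and> Y \<in> V} \<and> U \<inter> V = {0\<^sub>m k k}"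

definition bracket :: "complex mat \<Rightarrow> complex mat \<Rightarrow> complex mat" where
  "bracket X Y = X * Y - Y * X"

definition lie_algebra :: "nat \<Rightarrow> complex mat set \<Rightarrow> bool" where
  "lie_algebra k L \<longleftrightarrow> mat_subspace k L \<and> (\<forall>X\<in>L. \<forall>Y\<in>L. bracket X Y \<in> L)"

definition lie_subalgebra :: "nat \<Rightarrow> complex mat set \<Rightarrow> complex mat set \<Rightarrow> bool" where
  "lie_subalgebra k K L \<longleftrightarrow> lie_algebra k L \<and> lie_algebra k K \<and> K \<subseteq> L"

definition lie_iso :: "(complex mat \<Rightarrow> complex mat) \<Rightarrow> complex mat set \<Rightarrow> complex mat set \<Rightarrow> bool" where
  "lie_iso \<phi> L M \<longleftrightarrow>
     bij_betw \<phi> L M \<and>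
     (\<forall>X\<in>L. \<forall>Y\<in>L. \<phi> (X + Y) = \<phi> X + \<phi> Y) \<and>
     (\<forall>c. \<forall>X\<in>L. \<phi> (c \<cdot>\<^sub>m X) = c \<cdot>\<^sub>m \<phi> X) \<and>
     (\<forall>X\<in>L. \<forall>Y\<in>L. \<phi> (bracket X Y) = bracket (\<phi> X) (\<phi> Y))"

definition lie_isomorphic :: "complex mat set \<Rightarrow> complex mat set \<Rightarrow> bool" where
  "lie_isomorphic L M \<longleftrightarrow> (\<exists>\<phi>. lie_iso \<phi> L M)"

text \<open>An involution is an automorphism of order exactly two.\<close>

definition lie_involution :: "(complex mat \<Rightarrow> complex mat) \<Rightarrow> complex mat set \<Rightarrow> bool" where
  "lie_involution \<phi> L \<longleftrightarrow>
     lie_iso \<phi> L L \<and> (\<forall>Z\<in>L. \<phi> (\<phi> Z) = Z) \<and> (\<exists>Z\<in>L. \<phi> Z \<noteq> Z)"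

definition so :: "nat \<Rightarrow> complex mat set" where
  "so k = {X \<in> carrier_mat k k. transpose_mat X = - X}"

text \<open>The classical Lie algebra of type \<open>D\<^sub>m\<close> is, by definition, the even
  orthogonal algebra \<open>so(2m)\<close>.\<close>

definition type_D :: "nat \<Rightarrow> complex mat set \<Rightarrow> bool" where
  "type_D m L \<longleftrightarrow> lie_isomorphic L (so (2 * m))"


text \<open>Indices start at 0, so the anti-diagonal is \<open>i + j = n - 1\<close>.\<close>

definition J :: "nat \<Rightarrow> complex mat" where
  "J n = mat n n (\<lambda>(i, j). if i + j + 1 = n then 1 else 0)"

definition tilde :: "nat \<Rightarrow> complex mat \<Rightarrow> complex mat" where
  "tilde n X = J n * transpose_mat X * J n"

definition g :: "nat \<Rightarrow> complex mat set" where
  "g n = {four_block_mat A B C (- tilde n A) | A B C.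
     A \<in> carrier_mat n n \<and> B \<in> carrier_mat n n \<and> C \<in> carrier_mat n n \<and>
     B = - tilde n B \<and> C = - tilde n C}"

definition lam :: "nat \<Rightarrow> complex mat \<Rightarrow> complex mat" where
  "lam n Z = (case split_block Z n n of (A, B, C, D) \<Rightarrow> four_block_mat (- tilde n A) C B A)"

definition g0 :: "nat \<Rightarrow> complex mat set" where
  "g0 n = {Z \<in> g n. lam n Z = Z}"

definition g1 :: "nat \<Rightarrow> complex mat set" where
  "g1 n = {Z \<in> g n. lam n Z = - Z}"

definition g0_tilde :: "nat \<Rightarrow> complex mat set" where
  "g0_tilde n = {Z \<in> g0 n. \<exists>X Y. X \<in> carrier_mat n n \<and> Y \<in> carrier_mat n n \<and>
     Z = four_block_mat X Y Y X \<and> Y = 0\<^sub>m n n}"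

definition V :: "nat \<Rightarrow> complex mat set" where
  "V n = {Z \<in> g0 n. \<exists>X Y. X \<in> carrier_mat n n \<and> Y \<in> carrier_mat n n \<and>
     Z = four_block_mat X Y Y X \<and> X = 0\<^sub>m n n}"

end

(*
  Conjugation by the block swap S is the involution, and the given algebra is the algebra of all
  Z with tilde Z = -Z, i.e. the algebra preserving the symmetric form J.  The matrix
  P = (1-i)/2 1 + (1+i)/2 J is symmetric and satisfies P^2 = J, so P J P^T = 1 and conjugation by P
  carries the algebra preserving J onto the one preserving the standard form.
*)
theory Submission
  imports Defs
begin

section \<open>Square matrices\<close>

text \<open>On the origin of \<open>P\<close>: \<open>J\<close> squares to 1, so the space splits
  into its eigenspaces for 1 and -1, and a square root of \<open>J\<close> may act as 1 on the
  former and as -i on the latter. Solving a + b = 1 and a - b = -i turns this into a linear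
  polynomial in \<open>J\<close>. As such a polynomial the root commutes with \<open>J\<close> and
  inherits its symmetry, and so does its inverse. Over the reals no change of basis would do for n
  \<ge> 2, since the form \<open>J\<close> is indefinite; this is where i comes from.

  The anti-diagonal form appears at two sizes: at \<open>2 * n\<close> it describes the whole
  algebra, and at \<open>n\<close> it describes each of the blocks X and Y of a fixed element. Hence
  the comparison with the standard orthogonal algebra is made once, for arbitrary size, and applied
  to both.\<close>

lemma assoc_mult_square_mat:
  "\<lbrakk>A \<in> carrier_mat k k; B \<in> carrier_mat k k; C \<in> carrier_mat k k\<rbrakk>
    \<Longrightarrow> (A * B) * C = A * (B * C :: 'a :: semiring_0 mat)"
  by (rule assoc_mult_mat)

lemma mult_square_carrier_mat:
  "\<lbrakk>A \<in> carrier_mat k k; B \<in> carrier_mat k k\<rbrakk> \<Longrightarrow> A * B \<in> carrier_mat k k"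
  by (rule mult_carrier_mat)

text \<open>Once products are associated to the right, \<open>A * B\<close> is no longer a subterm
  when a factor follows. This form lets the simplifier cancel an inverse pair in the middle of a
  longer product.\<close>

lemma mult_cancel_middle_mat:
  fixes A :: "'a :: semiring_1 mat"
  assumes "A * B = 1\<^sub>m k" "A \<in> carrier_mat k k" "B \<in> carrier_mat k k" "C \<in> carrier_mat k k"
  shows "A * (B * C) = C"
  using assms by (metis assoc_mult_square_mat left_mult_one_mat)

lemma uminus_eq_smult_mat: "- X = (- 1 :: 'a :: ring_1) \<cdot>\<^sub>m X"
  by (rule eq_matI) auto

lemma uminus_zero_mat [simp]: "- 0\<^sub>m m n = (0\<^sub>m m n :: 'a :: group_add mat)"
  by (rule eq_matI) auto

lemma subspace_uminus:
  assumes "mat_subspace k L" "X \<in> L"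
  shows "- X \<in> L"
  using assms unfolding mat_subspace_def uminus_eq_smult_mat by blast

lemma subspace_carrier: "mat_subspace k L \<Longrightarrow> X \<in> L \<Longrightarrow> X \<in> carrier_mat k k"
  unfolding mat_subspace_def by blast

section \<open>Isomorphisms and involutions of matrix Lie algebras\<close>

lemma lie_isomorphic_trans:
  assumes "lie_isomorphic L M" "lie_isomorphic M N"
  shows "lie_isomorphic L N"
proof -
  obtain \<phi> \<psi> where \<phi>: "lie_iso \<phi> L M" and \<psi>: "lie_iso \<psi> M N"
    using assms unfolding lie_isomorphic_def by blast
  have mem: "\<phi> X \<in> M" if "X \<in> L" for X
    using \<phi> that unfolding lie_iso_def by (blast dest: bij_betwE)
  have "lie_iso (\<psi> \<circ> \<phi>) L N"
    unfolding lie_iso_def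
  proof (intro conjI)
    show "bij_betw (\<psi> \<circ> \<phi>) L N"
      using \<phi> \<psi> unfolding lie_iso_def by (blast intro: bij_betw_trans)
  qed (use \<phi> \<psi> mem in \<open>auto simp: lie_iso_def\<close>)
  then show ?thesis unfolding lie_isomorphic_def by blast
qed

text \<open>The map \<open>\<phi>\<close> only has to agree with the conjugation on
  \<open>L\<close>. This matters for \<open>lam\<close>, whose formula in blocks is a conjugation on
  the algebra but not on arbitrary matrices.\<close>

lemma lie_iso_conjugation:
  assumes P: "P \<in> carrier_mat k k" and Q: "Q \<in> carrier_mat k k"
    and PQ: "P * Q = 1\<^sub>m k" and QP: "Q * P = 1\<^sub>m k"
    and L: "L \<subseteq> carrier_mat k k" and M: "M \<subseteq> carrier_mat k k"
    and fwd: "\<And>X. X \<in> L \<Longrightarrow> P * X * Q \<in> M" and bwd: "\<And>X. X \<in> M \<Longrightarrow> Q * X * P \<in> L"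
    and \<phi>: "\<And>X. X \<in> L \<Longrightarrow> \<phi> X = P * X * Q"
    and add: "\<And>X Y. \<lbrakk>X \<in> L; Y \<in> L\<rbrakk> \<Longrightarrow> X + Y \<in> L"
    and smult: "\<And>c X. X \<in> L \<Longrightarrow> c \<cdot>\<^sub>m X \<in> L"
    and br: "\<And>X Y. \<lbrakk>X \<in> L; Y \<in> L\<rbrakk> \<Longrightarrow> bracket X Y \<in> L"
  shows "lie_iso \<phi> L M"
proof -
  note simps = assoc_mult_square_mat[where k = k] mult_square_carrier_mat[where k = k]
    mult_cancel_middle_mat[OF PQ P Q] mult_cancel_middle_mat[OF QP Q P]
  have bij: "bij_betw \<phi> L M"
  proof (rule bij_betw_byWitness[where f' = "\<lambda>X. Q * X * P"])
    show "\<forall>X\<in>L. Q * \<phi> X * P = X"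
    proof
      fix X assume "X \<in> L"
      then show "Q * \<phi> X * P = X" using L P Q QP by (auto simp: \<phi> simps)
    qed
    show "\<forall>X\<in>M. \<phi> (Q * X * P) = X"
    proof
      fix X assume "X \<in> M"
      then show "\<phi> (Q * X * P) = X" using M P Q PQ \<phi>[OF bwd] by (auto simp: simps)
    qed
  qed (use fwd bwd \<phi> in auto)
  \<comment> \<open>The inner \<open>Q * P\<close> collapses. Multiplicativity of the conjugation
    then gives compatibility with commutators.\<close>
  have mult: "(P * X * Q) * (P * Y * Q) = P * (X * Y) * Q"
    if "X \<in> carrier_mat k k" "Y \<in> carrier_mat k k" for X Y
    using that P Q by (simp add: simps)
  have "\<phi> (X + Y) = \<phi> X + \<phi> Y" if "X \<in> L" "Y \<in> L" for X Y
  proof -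
    have "X \<in> carrier_mat k k" "Y \<in> carrier_mat k k" using that L by auto
    then show ?thesis
      using that P Q by (simp add: \<phi> add mult_add_distrib_mat[of _ k k _ k]
          add_mult_distrib_mat[of _ k k _ _ k] mult_square_carrier_mat)
  qed
  moreover have "\<phi> (c \<cdot>\<^sub>m X) = c \<cdot>\<^sub>m \<phi> X" if "X \<in> L" for c X
  proof -
    have "X \<in> carrier_mat k k" using that L by auto
    then show ?thesis
      using that P Q by (simp add: \<phi> smult mult_smult_distrib[of _ k k _ k]
          mult_smult_assoc_mat[of _ k k _ k] mult_square_carrier_mat)
  qed
  moreover have "\<phi> (bracket X Y) = bracket (\<phi> X) (\<phi> Y)" if "X \<in> L" "Y \<in> L" for X Y
  proof -
    have XY: "X \<in> carrier_mat k k" "Y \<in> carrier_mat k k" using that L by auto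
    have "\<phi> (bracket X Y) = P * (X * Y - Y * X) * Q"
      using \<phi>[OF br[OF that]] unfolding bracket_def .
    also have "\<dots> = P * (X * Y) * Q - P * (Y * X) * Q"
      using XY P Q by (simp add: mult_minus_distrib_mat[of _ k k _ k]
          minus_mult_distrib_mat[of _ k k _ _ k] mult_square_carrier_mat)
    finally show ?thesis using that XY by (simp add: bracket_def \<phi> mult)
  qed
  ultimately show ?thesis using bij unfolding lie_iso_def by blast
qed

text \<open>The splitting averages: Z is the sum of (Z + \<phi> Z)/2 and (Z - \<phi> Z)/2. Only the
  fixed space is a Lie algebra, because the bracket of two elements negated by \<open>\<phi>\<close>
  is fixed by it.\<close>

lemma involution_eigenspaces:
  assumes L: "lie_algebra k L" and inv: "lie_involution \<phi> L"
  shows "lie_algebra k {Z \<in> L. \<phi> Z = Z}"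
    and "direct_sum k L {Z \<in> L. \<phi> Z = Z} {Z \<in> L. \<phi> Z = - Z}"
proof -
  have sub: "mat_subspace k L" using L unfolding lie_algebra_def by blast
  note carr = subspace_carrier[OF sub]
  have mem: "\<phi> X \<in> L" if "X \<in> L" for X
    using inv that unfolding lie_involution_def lie_iso_def by (blast dest: bij_betwE)
  have add: "\<phi> (X + Y) = \<phi> X + \<phi> Y" if "X \<in> L" "Y \<in> L" for X Y
    using inv that unfolding lie_involution_def lie_iso_def by blast
  have smult: "\<phi> (c \<cdot>\<^sub>m X) = c \<cdot>\<^sub>m \<phi> X" if "X \<in> L" for c X
    using inv that unfolding lie_involution_def lie_iso_def by blast
  have br: "\<phi> (bracket X Y) = bracket (\<phi> X) (\<phi> Y)" if "X \<in> L" "Y \<in> L" for X Y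
    using inv that unfolding lie_involution_def lie_iso_def by blast
  have invol: "\<phi> (\<phi> X) = X" if "X \<in> L" for X
    using inv that unfolding lie_involution_def by blast
  have zL: "0\<^sub>m k k \<in> L" and addL: "\<And>X Y. X \<in> L \<Longrightarrow> Y \<in> L \<Longrightarrow> X + Y \<in> L"
    and smultL: "\<And>c X. X \<in> L \<Longrightarrow> c \<cdot>\<^sub>m X \<in> L"
    using sub unfolding mat_subspace_def by blast+
  \<comment> \<open>Zero is rewritten as the scalar 0 times itself, so that homogeneity of
    \<open>\<phi>\<close> determines its image.\<close>
  have zero: "\<phi> (0\<^sub>m k k) = 0\<^sub>m k k"
  proof -
    have "\<phi> (0 \<cdot>\<^sub>m 0\<^sub>m k k) = 0 \<cdot>\<^sub>m \<phi> (0\<^sub>m k k)" by (rule smult[OF zL])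
    moreover have "0 \<cdot>\<^sub>m X = 0\<^sub>m k k" if "X \<in> carrier_mat k k" for X :: "complex mat"
      using that by (intro eq_matI) auto
    ultimately show ?thesis using carr[OF mem[OF zL]] by simp
  qed
  have sub0: "mat_subspace k {Z \<in> L. \<phi> Z = Z}"
    unfolding mat_subspace_def using carr zL addL smultL add smult zero by auto
  have addneg: "- X + - Y = - (X + Y)" if "X \<in> L" "Y \<in> L" for X Y
    using carr[OF that(1)] carr[OF that(2)] by (intro eq_matI) auto
  have smultneg: "c \<cdot>\<^sub>m (- X) = - (c \<cdot>\<^sub>m X)" for c and X :: "complex mat"
    by (rule eq_matI) auto
  have sub1: "mat_subspace k {Z \<in> L. \<phi> Z = - Z}"
    unfolding mat_subspace_def
    using carr zL addL smultL add smult zero addneg smultneg by auto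
  show "lie_algebra k {Z \<in> L. \<phi> Z = Z}"
    using sub0 br L unfolding lie_algebra_def by auto
  have "L = {X + Y | X Y. X \<in> {Z \<in> L. \<phi> Z = Z} \<and> Y \<in> {Z \<in> L. \<phi> Z = - Z}}"
  proof (intro equalityI subsetI)
    fix Z assume Z: "Z \<in> L"
    define X where "X = (1/2) \<cdot>\<^sub>m (Z + \<phi> Z)"
    \<comment> \<open>Written as a sum with a negative because closure of \<open>L\<close> and
      additivity of \<open>\<phi>\<close> are available for sums, not for differences.\<close>
    define Y where "Y = (1/2) \<cdot>\<^sub>m (Z + - \<phi> Z)"
    note cs = carr[OF Z] carr[OF mem[OF Z]]
    have nL: "- \<phi> Z \<in> L" by (rule subspace_uminus[OF sub mem[OF Z]])
    have nphi: "\<phi> (- \<phi> Z) = - Z"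
      using smult[OF mem[OF Z]] invol[OF Z] unfolding uminus_eq_smult_mat by simp
    have "X \<in> L" "Y \<in> L" unfolding X_def Y_def using Z mem nL addL smultL by blast+
    moreover have "\<phi> X = X"
      unfolding X_def using cs by (simp add: smult add addL mem Z invol comm_add_mat)
    moreover have "\<phi> Y = (1/2) \<cdot>\<^sub>m (\<phi> Z + - Z)"
      unfolding Y_def by (simp add: smult add addL nL Z nphi)
    then have "\<phi> Y = - Y"
      unfolding Y_def using cs by (auto intro!: eq_matI simp: algebra_simps)
    moreover have "Z = X + Y"
      unfolding X_def Y_def using cs by (auto intro!: eq_matI simp: field_simps)
    ultimately show "Z \<in> {X + Y | X Y. X \<in> {Z \<in> L. \<phi> Z = Z} \<and> Y \<in> {Z \<in> L. \<phi> Z = - Z}}"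
      by blast
  qed (use addL in auto)
  moreover have "{Z \<in> L. \<phi> Z = Z} \<inter> {Z \<in> L. \<phi> Z = - Z} = {0\<^sub>m k k}"
  proof -
    have "Z = 0\<^sub>m k k" if "Z \<in> L" "\<phi> Z = Z" "\<phi> Z = - Z" for Z
    proof (rule eq_matI)
      note c = carr[OF that(1)]
      fix i j assume "i < dim_row (0\<^sub>m k k)" "j < dim_col (0\<^sub>m k k)"
      then have ij: "i < k" "j < k" by auto
      have "Z $$ (i,j) = (- Z) $$ (i,j)" using that(2) unfolding that(3) by (rule arg_cong[OF sym])
      also have "\<dots> = - (Z $$ (i,j))" using c ij by simp
      finally show "Z $$ (i,j) = 0\<^sub>m k k $$ (i,j)" using ij by simp
    qed (use carr[OF that(1)] in auto)
    then have "{Z \<in> L. \<phi> Z = Z} \<inter> {Z \<in> L. \<phi> Z = - Z} \<subseteq> {0\<^sub>m k k}" by blast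
    moreover have "0\<^sub>m k k \<in> {Z \<in> L. \<phi> Z = Z} \<inter> {Z \<in> L. \<phi> Z = - Z}" using zL zero by simp
    ultimately show ?thesis by blast
  qed
  ultimately show "direct_sum k L {Z \<in> L. \<phi> Z = Z} {Z \<in> L. \<phi> Z = - Z}"
    unfolding direct_sum_def using sub0 sub1 by blast
qed

section \<open>Reflection in the anti-diagonal\<close>

lemma J_carrier [simp]: "J n \<in> carrier_mat n n"
  by (simp add: J_def)

lemma J_transpose [simp]: "transpose_mat (J n) = J n"
  by (rule eq_matI) (auto simp: J_def add.commute)

lemma J_mult_index:
  assumes "X \<in> carrier_mat n m" "i < n" "j < m"
  shows "(J n * X) $$ (i, j) = X $$ (n - 1 - i, j)"
proof -
  have "(J n * X) $$ (i, j) = (\<Sum>l = 0..<n. (if i + l + 1 = n then 1 else 0) * X $$ (l, j))"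
    using assms by (simp add: J_def scalar_prod_def)
  \<comment> \<open>The condition defining the anti-diagonal is solved for \<open>l\<close>. The
    natural subtraction does not truncate, since \<open>i < n\<close>.\<close>
  also have "\<dots> = (\<Sum>l = 0..<n. if l = n - 1 - i then X $$ (l, j) else 0)"
    using assms by (intro sum.cong) auto
  also have "\<dots> = X $$ (n - 1 - i, j)" using assms by simp
  finally show ?thesis .
qed

lemma mult_J_index:
  assumes "X \<in> carrier_mat m n" "i < m" "j < n"
  shows "(X * J n) $$ (i, j) = X $$ (i, n - 1 - j)"
proof -
  have "(X * J n) $$ (i, j) = (\<Sum>l = 0..<n. X $$ (i, l) * (if l + j + 1 = n then 1 else 0))"
    using assms by (simp add: J_def scalar_prod_def)
  also have "\<dots> = (\<Sum>l = 0..<n. if l = n - 1 - j then X $$ (i, l) else 0)"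
    using assms by (intro sum.cong) auto
  also have "\<dots> = X $$ (i, n - 1 - j)" using assms by simp
  finally show ?thesis .
qed

lemma J_square [simp]: "J n * J n = 1\<^sub>m n"
proof (rule eq_matI)
  fix i j assume "i < dim_row (1\<^sub>m n)" "j < dim_col (1\<^sub>m n)"
  then show "(J n * J n) $$ (i, j) = 1\<^sub>m n $$ (i, j)"
    by (subst J_mult_index[where m = n]) (auto simp: J_def)
qed (auto simp: J_def)

lemmas J_cancel = mult_cancel_middle_mat[OF J_square J_carrier J_carrier]

lemma tilde_carrier [simp]: "X \<in> carrier_mat n n \<Longrightarrow> tilde n X \<in> carrier_mat n n"
  unfolding tilde_def by (intro mult_square_carrier_mat) auto

text \<open>Multiplying by \<open>J\<close> on the left reverses the rows and on the right the
  columns, so together with the transpose \<open>tilde\<close> is the reflection in the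
  anti-diagonal. Its linear properties then follow entry by entry.\<close>

lemma tilde_index [simp]:
  assumes "X \<in> carrier_mat n n" "i < n" "j < n"
  shows "tilde n X $$ (i, j) = X $$ (n - 1 - j, n - 1 - i)"
proof -
  have "tilde n X $$ (i, j) = (J n * transpose_mat X) $$ (i, n - 1 - j)"
    unfolding tilde_def using assms
    by (intro mult_J_index[where m = n] mult_square_carrier_mat) auto
  also have "\<dots> = transpose_mat X $$ (n - 1 - i, n - 1 - j)"
    using assms by (intro J_mult_index[where m = n]) auto
  finally show ?thesis using assms by simp
qed

lemma tilde_dim [simp]: "dim_row (tilde n X) = n" "dim_col (tilde n X) = n"
  by (simp_all add: tilde_def J_def)

lemma tilde_tilde [simp]: "X \<in> carrier_mat n n \<Longrightarrow> tilde n (tilde n X) = X"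
  by (rule eq_matI) auto

lemma tilde_uminus [simp]: "X \<in> carrier_mat n n \<Longrightarrow> tilde n (- X) = - tilde n X"
  by (rule eq_matI) auto

lemma tilde_zero [simp]: "tilde n (0\<^sub>m n n) = 0\<^sub>m n n"
  by (rule eq_matI) auto

lemma tilde_one: "tilde n (1\<^sub>m n) = 1\<^sub>m n"
  by (rule eq_matI) auto

lemma tilde_add:
  "\<lbrakk>X \<in> carrier_mat n n; Y \<in> carrier_mat n n\<rbrakk> \<Longrightarrow> tilde n (X + Y) = tilde n X + tilde n Y"
  by (rule eq_matI) auto

lemma tilde_minus:
  "\<lbrakk>X \<in> carrier_mat n n; Y \<in> carrier_mat n n\<rbrakk> \<Longrightarrow> tilde n (X - Y) = tilde n X - tilde n Y"
  by (rule eq_matI) (auto simp: minus_carrier_mat)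

lemma tilde_smult: "X \<in> carrier_mat n n \<Longrightarrow> tilde n (c \<cdot>\<^sub>m X) = c \<cdot>\<^sub>m tilde n X"
  by (rule eq_matI) auto

text \<open>Transposition reverses the product, and the factor \<open>J * J\<close> inserted between
  the two reflected matrices is 1.\<close>

lemma tilde_mult:
  assumes "X \<in> carrier_mat n n" "Y \<in> carrier_mat n n"
  shows "tilde n (X * Y) = tilde n Y * tilde n X"
  using assms unfolding tilde_def
  by (simp add: transpose_mult[of _ n n _ n] assoc_mult_square_mat[where k = n]
      mult_square_carrier_mat[where k = n] J_cancel)

lemma transpose_eq_tilde:
  assumes "X \<in> carrier_mat n n"
  shows "transpose_mat X = J n * tilde n X * J n"
  using assms unfolding tilde_def
  by (simp add: assoc_mult_square_mat[where k = n] mult_square_carrier_mat[where k = n] J_cancel)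

text \<open>Reflection in the large anti-diagonal exchanges the two diagonal blocks, keeps the
  off-diagonal blocks in place, and reflects each block in its own anti-diagonal.\<close>

lemma tilde_four_block:
  assumes "A \<in> carrier_mat n n" "B \<in> carrier_mat n n" "C \<in> carrier_mat n n" "D \<in> carrier_mat n n"
  shows "tilde (2 * n) (four_block_mat A B C D) =
    four_block_mat (tilde n D) (tilde n B) (tilde n C) (tilde n A)"
proof (rule eq_matI)
  have Z: "four_block_mat A B C D \<in> carrier_mat (2 * n) (2 * n)"
    using four_block_carrier_mat[OF assms(1,4)] by (simp add: mult_2)
  let ?R = "four_block_mat (tilde n D) (tilde n B) (tilde n C) (tilde n A)"
  fix i j assume "i < dim_row ?R" "j < dim_col ?R"
  then have "i < 2 * n" "j < 2 * n" by auto
  \<comment> \<open>Reversing an index moves it to the other half. These equations give its offset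
    there, from the first half to the second and then from the second to the first.\<close>
  moreover have "2 * n - Suc i - n = n - Suc i" "2 * n - Suc j - n = n - Suc j" by auto
  moreover have "2 * n - Suc i = n - Suc (i - n)" if "\<not> i < n" using that by auto
  moreover have "2 * n - Suc j = n - Suc (j - n)" if "\<not> j < n" using that by auto
  ultimately show "tilde (2 * n) (four_block_mat A B C D) $$ (i, j) = ?R $$ (i, j)"
    using assms Z by (cases "i < n"; cases "j < n") auto
qed auto

section \<open>The orthogonal algebra of the anti-diagonal form\<close>

text \<open>Multiplying the condition by \<open>J\<close> on the left gives X^T J + J X = 0, the
  infinitesimal invariance of the bilinear form with matrix \<open>J\<close>.\<close>

definition so_anti :: "nat \<Rightarrow> complex mat set" where
  "so_anti n = {X \<in> carrier_mat n n. tilde n X = - X}"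

text \<open>An anti-automorphism negates the commutator of two matrices that it negates: the signs
  cancel in each product, and the order is reversed.\<close>

lemma lie_algebra_so_anti: "lie_algebra n (so_anti n)"
  unfolding lie_algebra_def mat_subspace_def
proof (intro conjI ballI allI)
  fix X Y assume "X \<in> so_anti n" "Y \<in> so_anti n"
  then have *: "X \<in> carrier_mat n n" "Y \<in> carrier_mat n n" "tilde n X = - X" "tilde n Y = - Y"
    by (auto simp: so_anti_def)
  show "X + Y \<in> so_anti n"
    using * by (auto simp: so_anti_def tilde_add intro!: eq_matI)
  have "tilde n (bracket X Y) = (- Y) * (- X) - (- X) * (- Y)"
    using * by (simp add: bracket_def tilde_minus tilde_mult mult_square_carrier_mat)
  also have "\<dots> = Y * X - X * Y" using * by simp
  also have "\<dots> = - bracket X Y" using * unfolding bracket_def by (intro eq_matI) auto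
  finally show "bracket X Y \<in> so_anti n"
    using * by (auto simp: so_anti_def bracket_def mult_square_carrier_mat)
qed (auto simp: so_anti_def tilde_smult intro!: eq_matI)

lemma lie_isomorphic_so_anti: "lie_isomorphic (so_anti n) (so n)"
proof -
  define a b :: complex where "a = (1 - \<i>) / 2" and "b = (1 + \<i>) / 2"
  \<comment> \<open>These are the coefficients of 1 and of \<open>J\<close> in the square of
    \<open>a + b J\<close>, using that \<open>J\<close> squares to 1.\<close>
  have ab: "a * a + b * b = 0" "a * b + a * b = 1"
    by (simp_all add: a_def b_def field_simps)
  define P where "P = a \<cdot>\<^sub>m 1\<^sub>m n + b \<cdot>\<^sub>m J n"
  have P: "P \<in> carrier_mat n n" unfolding P_def by simp
  have PT: "transpose_mat P = P"
    unfolding P_def by (rule eq_matI) (auto simp: J_def add.commute)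
  have JP: "J n * P = a \<cdot>\<^sub>m J n + b \<cdot>\<^sub>m 1\<^sub>m n" and PJ: "P * J n = a \<cdot>\<^sub>m J n + b \<cdot>\<^sub>m 1\<^sub>m n"
    unfolding P_def by (simp_all add: mult_add_distrib_mat[of _ n n _ n]
        add_mult_distrib_mat[of _ n n _ _ n] mult_smult_distrib[of _ n n _ n]
        mult_smult_assoc_mat[of _ n n _ n] left_mult_one_mat[of _ n n] right_mult_one_mat[of _ n n])
  have comm: "J n * P = P * J n" using JP PJ by simp
  have "P * P = a \<cdot>\<^sub>m P + b \<cdot>\<^sub>m (J n * P)"
    using P by (subst (1) P_def) (simp add: add_mult_distrib_mat[of _ n n _ _ n]
        mult_smult_assoc_mat[of _ n n _ n] left_mult_one_mat[of _ n n])
  also have "\<dots> = (a * a + b * b) \<cdot>\<^sub>m 1\<^sub>m n + (a * b + a * b) \<cdot>\<^sub>m J n"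
    unfolding JP unfolding P_def by (rule eq_matI) (auto simp: J_def algebra_simps)
  also have "\<dots> = J n" unfolding ab by (rule eq_matI) (auto simp: J_def)
  finally have PP: "P * P = J n" .
  \<comment> \<open>The inverse of \<open>P\<close>: as \<open>J\<close> is the square of
    \<open>P\<close>, the product of \<open>J * P\<close> with \<open>P\<close> is
    \<open>J * J\<close>, which is 1.\<close>
  define Q where "Q = J n * P"
  have Q: "Q \<in> carrier_mat n n" unfolding Q_def using P by (simp add: mult_square_carrier_mat)
  have QT: "transpose_mat Q = Q"
    unfolding Q_def using P PT comm by (simp add: transpose_mult[of _ n n _ n])
  note simps = assoc_mult_square_mat[where k = n] mult_square_carrier_mat[where k = n]
  have JQ: "J n * Q = P" unfolding Q_def using P by (rule J_cancel)
  have QJ: "Q * J n = P" unfolding Q_def using P by (simp add: simps flip: comm add: J_cancel)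
  have QP: "Q * P = 1\<^sub>m n" unfolding Q_def using P by (simp add: simps PP)
  have PQ: "P * Q = 1\<^sub>m n" unfolding Q_def comm using P
    by (simp add: PP flip: assoc_mult_square_mat[where k = n])
  have "lie_iso (\<lambda>X. P * X * Q) (so_anti n) (so n)"
  proof (rule lie_iso_conjugation[OF P Q PQ QP])
    show "P * X * Q \<in> so n" if "X \<in> so_anti n" for X
    proof -
      have X: "X \<in> carrier_mat n n" "tilde n X = - X" using that by (auto simp: so_anti_def)
      \<comment> \<open>Transposition exchanges the symmetric outer factors. The two copies of
        \<open>J\<close> coming from the transpose of X turn \<open>Q\<close> back into
        \<open>P\<close> and \<open>P\<close> back into \<open>Q\<close>.\<close>
      have "transpose_mat (P * X * Q) = Q * (J n * (- X) * J n) * P"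
        using X P Q by (simp add: transpose_mult[of _ n n _ n] simps PT QT transpose_eq_tilde)
      also have "\<dots> = (Q * J n) * (- X) * (J n * P)"
        using X P Q by (simp add: simps del: uminus_mult_left_mat uminus_mult_right_mat)
      also have "\<dots> = - (P * X * Q)" using X P Q unfolding QJ Q_def[symmetric] by simp
      finally show ?thesis using X P Q by (simp add: so_def simps)
    qed
    show "Q * X * P \<in> so_anti n" if "X \<in> so n" for X
    proof -
      have X: "X \<in> carrier_mat n n" "transpose_mat X = - X" using that by (auto simp: so_def)
      \<comment> \<open>Here the copies of \<open>J\<close> stand outside, from the definition of
        \<open>tilde\<close>, and are absorbed by the outer factors in the same way.\<close>
      have "tilde n (Q * X * P) = J n * (P * (- X) * Q) * J n"
        unfolding tilde_def
        using X P Q by (simp add: transpose_mult[of _ n n _ n] simps PT QT)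
      also have "\<dots> = (J n * P) * (- X) * (Q * J n)"
        using X P Q by (simp add: simps del: uminus_mult_left_mat uminus_mult_right_mat)
      also have "\<dots> = - (Q * X * P)" using X P Q unfolding QJ Q_def[symmetric] by simp
      finally show ?thesis using X P Q by (simp add: so_anti_def simps)
    qed
  qed (use lie_algebra_so_anti[of n] in
      \<open>auto simp: lie_algebra_def mat_subspace_def so_def\<close>)
  then show ?thesis unfolding lie_isomorphic_def by blast
qed

section \<open>The involution\<close>

lemma split_block_four_block:
  assumes "A \<in> carrier_mat n n" "B \<in> carrier_mat n n" "C \<in> carrier_mat n n" "D \<in> carrier_mat n n"
  shows "split_block (four_block_mat A B C D) n n = (A, B, C, D)"
  unfolding split_block_def Let_def using assms by (auto intro!: eq_matI)

text \<open>With all block sizes fixed, \<open>split_block\<close> recovers the blocks. Equations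
  between block matrices thereby become four equations each.\<close>

lemma four_block_inject:
  assumes "A \<in> carrier_mat n n" "B \<in> carrier_mat n n" "C \<in> carrier_mat n n" "D \<in> carrier_mat n n"
    "A' \<in> carrier_mat n n" "B' \<in> carrier_mat n n" "C' \<in> carrier_mat n n" "D' \<in> carrier_mat n n"
  shows "four_block_mat A B C D = four_block_mat A' B' C' D' \<longleftrightarrow>
    A = A' \<and> B = B' \<and> C = C' \<and> D = D'"
  using split_block_four_block[OF assms(1-4)] split_block_four_block[OF assms(5-8)]
  by (metis prod.inject)

lemma uminus_four_block:
  assumes "A \<in> carrier_mat n n" "B \<in> carrier_mat n n" "C \<in> carrier_mat n n" "D \<in> carrier_mat n n"
  shows "- four_block_mat A B C D = four_block_mat (- A) (- B) (- C) (- D)"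
  using assms by (intro eq_matI) auto

lemma uminus_eq_iff_mat: "- X = Y \<longleftrightarrow> X = - (Y :: 'a :: group_add mat)"
  by auto

text \<open>Read blockwise, the anti-diagonal condition at size \<open>2 * n\<close> relates the two
  diagonal blocks and constrains each off-diagonal block separately. The two relations between the
  diagonal blocks are equivalent because \<open>tilde\<close> is its own inverse.\<close>

lemma g_eq_so_anti: "g n = so_anti (2 * n)"
proof (intro equalityI subsetI)
  fix Z assume "Z \<in> g n"
  then obtain A B C where Z: "Z = four_block_mat A B C (- tilde n A)"
    and c: "A \<in> carrier_mat n n" "B \<in> carrier_mat n n" "C \<in> carrier_mat n n"
    and BC: "B = - tilde n B" "C = - tilde n C" unfolding g_def by blast
  have "tilde n B = - B" "tilde n C = - C" using BC by (metis uminus_uminus_mat)+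
  then show "Z \<in> so_anti (2 * n)"
    using c four_block_carrier_mat[of A n n "- tilde n A" n n B C, folded mult_2]
    by (simp add: Z so_anti_def tilde_four_block uminus_four_block[where n = n])
next
  fix Z assume "Z \<in> so_anti (2 * n)"
  then have Zc: "Z \<in> carrier_mat (2 * n) (2 * n)" and Zt: "tilde (2 * n) Z = - Z"
    by (auto simp: so_anti_def)
  obtain A B C D where sp: "split_block Z n n = (A, B, C, D)" by (metis prod_cases4)
  have c: "A \<in> carrier_mat n n" "B \<in> carrier_mat n n" "C \<in> carrier_mat n n" "D \<in> carrier_mat n n"
    and Z: "Z = four_block_mat A B C D"
    using split_block[OF sp, of n n] Zc by auto
  from Zt c have "tilde n D = - A \<and> tilde n B = - B \<and> tilde n C = - C \<and> tilde n A = - D"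
    by (simp add: Z tilde_four_block uminus_four_block[where n = n] four_block_inject[where n = n])
  then have "D = - tilde n A" "B = - tilde n B" "C = - tilde n C" by auto
  with c Z show "Z \<in> g n" unfolding g_def by blast
qed

lemma lam_four_block:
  assumes "A \<in> carrier_mat n n" "B \<in> carrier_mat n n" "C \<in> carrier_mat n n" "D \<in> carrier_mat n n"
  shows "lam n (four_block_mat A B C D) = four_block_mat (- tilde n A) C B A"
  unfolding lam_def using split_block_four_block[OF assms] by simp

lemma lie_algebra_g: "lie_algebra (2 * n) (g n)"
  unfolding g_eq_so_anti by (rule lie_algebra_so_anti)

lemma lie_involution_lam:
  assumes "n > 0"
  shows "lie_involution (lam n) (g n)"
proof -
  define S :: "complex mat" where "S = four_block_mat (0\<^sub>m n n) (1\<^sub>m n) (1\<^sub>m n) (0\<^sub>m n n)"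
  have S: "S \<in> carrier_mat (2 * n) (2 * n)"
    unfolding S_def using four_block_carrier_mat[of "0\<^sub>m n n" n n "0\<^sub>m n n" n n] by (simp add: mult_2)
  have one: "four_block_mat (1\<^sub>m n) (0\<^sub>m n n) (0\<^sub>m n n) (1\<^sub>m n) = (1\<^sub>m (2 * n) :: complex mat)"
    by (rule eq_matI) auto
  have SS: "S * S = 1\<^sub>m (2 * n)"
    unfolding S_def by (simp add: mult_four_block_mat[of _ n n _ n _ n _ _ n _ n] one flip: mult_2)
  have St: "tilde (2 * n) S = S"
    unfolding S_def by (simp add: tilde_four_block tilde_one)
  \<comment> \<open>Conjugation by \<open>S\<close> moves the lower right block to the upper left.
    Membership in \<open>g n\<close> identifies that block with \<open>- tilde n A\<close>, as
    \<open>lam\<close> requires.\<close>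
  have lamS: "lam n Z = S * Z * S" and inv: "lam n (lam n Z) = Z" if "Z \<in> g n" for Z
  proof -
    obtain A B C where Z: "Z = four_block_mat A B C (- tilde n A)"
      and c: "A \<in> carrier_mat n n" "B \<in> carrier_mat n n" "C \<in> carrier_mat n n"
      using \<open>Z \<in> g n\<close> unfolding g_def by blast
    show "lam n Z = S * Z * S"
      using c unfolding Z S_def
      by (simp add: mult_four_block_mat[of _ n n _ n _ n _ _ n _ n] lam_four_block
          left_add_zero_mat[of _ n n] right_add_zero_mat[of _ n n])
    show "lam n (lam n Z) = Z"
      using c by (simp add: Z lam_four_block)
  qed
  \<comment> \<open>\<open>S\<close> is fixed by \<open>tilde\<close>, so applying
    \<open>tilde\<close> to \<open>S * Z * S\<close> only changes the sign of the middle
    factor.\<close>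
  have closed: "S * Z * S \<in> g n" if "Z \<in> g n" for Z
  proof -
    have "Z \<in> carrier_mat (2 * n) (2 * n)" "tilde (2 * n) Z = - Z"
      using that by (auto simp: g_eq_so_anti so_anti_def)
    then show ?thesis
      using S by (simp add: g_eq_so_anti so_anti_def tilde_mult St mult_square_carrier_mat
          assoc_mult_square_mat[where k = "2 * n"])
  qed
  have "lie_iso (lam n) (g n) (g n)"
    by (rule lie_iso_conjugation[OF S S SS SS _ _ closed closed lamS])
      (use lie_algebra_g[of n] in \<open>auto simp: lie_algebra_def mat_subspace_def\<close>)
  moreover have "\<exists>Z\<in>g n. lam n Z \<noteq> Z"
  proof
    \<comment> \<open>The matrix diag(1, -1), which \<open>lam\<close> negates.\<close>
    let ?Z = "four_block_mat (1\<^sub>m n) (0\<^sub>m n n) (0\<^sub>m n n) (- tilde n (1\<^sub>m n)) :: complex mat"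
    have z: "0\<^sub>m n n = - tilde n (0\<^sub>m n n)" by simp
    show "?Z \<in> g n" unfolding g_def using z one_carrier_mat zero_carrier_mat by blast
    have "- 1\<^sub>m n \<noteq> (1\<^sub>m n :: complex mat)"
    proof
      assume "- 1\<^sub>m n = (1\<^sub>m n :: complex mat)"
      \<comment> \<open>The entry (0, 0) exists because \<open>n > 0\<close>; for
        \<open>n = 0\<close> the algebra is trivial and \<open>lam\<close> is the identity on
        it.\<close>
      then have "(- 1\<^sub>m n) $$ (0, 0) = (1\<^sub>m n :: complex mat) $$ (0, 0)" by simp
      then show False using assms by simp
    qed
    then show "lam n ?Z \<noteq> ?Z"
      by (simp add: lam_four_block four_block_inject[where n = n] tilde_one)
  qed
  ultimately show ?thesis unfolding lie_involution_def using inv by blast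
qed

section \<open>The eigenspaces\<close>

lemma g0_eq:
  "g0 n = {four_block_mat X Y Y X | X Y.
     X \<in> carrier_mat n n \<and> Y \<in> carrier_mat n n \<and> tilde n X = - X \<and> tilde n Y = - Y}"
proof (intro equalityI subsetI)
  fix Z assume "Z \<in> g0 n"
  then obtain A B C where Z: "Z = four_block_mat A B C (- tilde n A)" and fx: "lam n Z = Z"
    and c: "A \<in> carrier_mat n n" "B \<in> carrier_mat n n" "C \<in> carrier_mat n n"
    and BC: "B = - tilde n B" unfolding g0_def g_def by blast
  have eq: "four_block_mat (- tilde n A) C B A = four_block_mat A B C (- tilde n A)"
    using fx c by (simp add: Z lam_four_block)
  have "- tilde n A = A \<and> C = B \<and> B = C \<and> A = - tilde n A"
    by (rule iffD1[OF four_block_inject[where n = n] eq]) (use c in simp_all)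
  then have "- tilde n A = A" "C = B" by blast+
  moreover have "tilde n B = - B" using BC by (metis uminus_uminus_mat)
  ultimately show "Z \<in> {four_block_mat X Y Y X | X Y.
     X \<in> carrier_mat n n \<and> Y \<in> carrier_mat n n \<and> tilde n X = - X \<and> tilde n Y = - Y}"
    using c Z by (auto simp: uminus_eq_iff_mat)
next
  fix Z assume "Z \<in> {four_block_mat X Y Y X | X Y.
     X \<in> carrier_mat n n \<and> Y \<in> carrier_mat n n \<and> tilde n X = - X \<and> tilde n Y = - Y}"
  then obtain X Y where Z: "Z = four_block_mat X Y Y X" and c: "X \<in> carrier_mat n n"
    "Y \<in> carrier_mat n n" and t: "tilde n X = - X" "tilde n Y = - Y" by blast
  have "Z = four_block_mat X Y Y (- tilde n X)" "Y = - tilde n Y" using Z t by simp_all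
  then have "Z \<in> g n" unfolding g_def using c by blast
  moreover have "lam n Z = Z" using c t by (simp add: Z lam_four_block)
  ultimately show "Z \<in> g0 n" unfolding g0_def by blast
qed

lemma g1_eq:
  "g1 n = {four_block_mat X Y (- Y) (- X) | X Y.
     X \<in> carrier_mat n n \<and> Y \<in> carrier_mat n n \<and> tilde n X = X \<and> tilde n Y = - Y}"
proof (intro equalityI subsetI)
  fix Z assume "Z \<in> g1 n"
  then obtain A B C where Z: "Z = four_block_mat A B C (- tilde n A)" and fx: "lam n Z = - Z"
    and c: "A \<in> carrier_mat n n" "B \<in> carrier_mat n n" "C \<in> carrier_mat n n"
    and BC: "B = - tilde n B" unfolding g1_def g_def by blast
  have eq: "four_block_mat (- tilde n A) C B A = four_block_mat (- A) (- B) (- C) (- (- tilde n A))"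
    using fx c by (simp add: Z lam_four_block uminus_four_block[where n = n])
  have "- tilde n A = - A \<and> C = - B \<and> B = - C \<and> A = - (- tilde n A)"
    by (rule iffD1[OF four_block_inject[where n = n] eq]) (use c in simp_all)
  then have "- tilde n A = - A" "C = - B" by blast+
  then have "tilde n A = A" "C = - B" by simp_all
  moreover have "tilde n B = - B" using BC by (metis uminus_uminus_mat)
  ultimately show "Z \<in> {four_block_mat X Y (- Y) (- X) | X Y.
     X \<in> carrier_mat n n \<and> Y \<in> carrier_mat n n \<and> tilde n X = X \<and> tilde n Y = - Y}"
    using c Z by auto
next
  fix Z assume "Z \<in> {four_block_mat X Y (- Y) (- X) | X Y.
     X \<in> carrier_mat n n \<and> Y \<in> carrier_mat n n \<and> tilde n X = X \<and> tilde n Y = - Y}"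
  then obtain X Y where Z: "Z = four_block_mat X Y (- Y) (- X)" and c: "X \<in> carrier_mat n n"
    "Y \<in> carrier_mat n n" and t: "tilde n X = X" "tilde n Y = - Y" by blast
  have "Z = four_block_mat X Y (- Y) (- tilde n X)" "Y = - tilde n Y" "- Y = - tilde n (- Y)"
    using Z t c by simp_all
  then have "Z \<in> g n" unfolding g_def using c uminus_carrier_mat by blast
  moreover have "lam n Z = - Z" using c t by (simp add: Z lam_four_block uminus_four_block[where n = n])
  ultimately show "Z \<in> g1 n" unfolding g1_def by blast
qed

section \<open>Splitting of the fixed algebra into diagonal and off-diagonal blocks\<close>

lemma g0_eq_so_anti: "g0 n = {four_block_mat X Y Y X | X Y. X \<in> so_anti n \<and> Y \<in> so_anti n}"
  unfolding g0_eq so_anti_def by (rule Collect_cong) (simp only: mem_Collect_eq conj_ac)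

lemma so_antiD:
  assumes "X \<in> so_anti n"
  shows "X \<in> carrier_mat n n" "tilde n X = - X"
  using assms by (auto simp: so_anti_def)

lemma so_anti_closed:
  shows "0\<^sub>m n n \<in> so_anti n"
    and "\<lbrakk>X \<in> so_anti n; Y \<in> so_anti n\<rbrakk> \<Longrightarrow> X + Y \<in> so_anti n"
    and "X \<in> so_anti n \<Longrightarrow> c \<cdot>\<^sub>m X \<in> so_anti n"
    and "\<lbrakk>X \<in> so_anti n; Y \<in> so_anti n\<rbrakk> \<Longrightarrow> bracket X Y \<in> so_anti n"
  using lie_algebra_so_anti[of n] by (simp_all add: lie_algebra_def mat_subspace_def)

text \<open>Blocks are determined by the matrix, so membership can be tested on them. This turns the
  existential descriptions of \<open>g0_tilde\<close> and \<open>V\<close> into images of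
  \<open>so_anti n\<close>, from which closure properties are transported.\<close>

lemma g0_block_mem_iff:
  assumes "X \<in> carrier_mat n n" "Y \<in> carrier_mat n n"
  shows "four_block_mat X Y Y X \<in> g0 n \<longleftrightarrow> X \<in> so_anti n \<and> Y \<in> so_anti n"
proof
  assume "four_block_mat X Y Y X \<in> g0 n"
  then obtain X' Y' where eq: "four_block_mat X Y Y X = four_block_mat X' Y' Y' X'"
    and mem: "X' \<in> so_anti n" "Y' \<in> so_anti n" unfolding g0_eq_so_anti by blast
  have "X = X' \<and> Y = Y' \<and> Y = Y' \<and> X = X'"
    by (rule iffD1[OF four_block_inject[where n = n] eq]) (use mem assms so_antiD(1) in auto)
  then show "X \<in> so_anti n \<and> Y \<in> so_anti n" using mem by simp
qed (auto simp: g0_eq_so_anti)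

lemma g0_tilde_eq: "g0_tilde n = (\<lambda>X. four_block_mat X (0\<^sub>m n n) (0\<^sub>m n n) X) ` so_anti n"
proof -
  have "g0_tilde n = {four_block_mat X (0\<^sub>m n n) (0\<^sub>m n n) X | X.
      X \<in> carrier_mat n n \<and> four_block_mat X (0\<^sub>m n n) (0\<^sub>m n n) X \<in> g0 n}"
    unfolding g0_tilde_def using zero_carrier_mat by blast
  then show ?thesis
    using so_antiD(1) so_anti_closed(1) by (auto simp: g0_block_mem_iff)
qed

lemma V_eq: "V n = (\<lambda>Y. four_block_mat (0\<^sub>m n n) Y Y (0\<^sub>m n n)) ` so_anti n"
proof -
  have "V n = {four_block_mat (0\<^sub>m n n) Y Y (0\<^sub>m n n) | Y.
      Y \<in> carrier_mat n n \<and> four_block_mat (0\<^sub>m n n) Y Y (0\<^sub>m n n) \<in> g0 n}"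
    unfolding V_def using zero_carrier_mat by blast
  then show ?thesis
    using so_antiD(1) so_anti_closed(1) by (auto simp: g0_block_mem_iff)
qed

lemma add_four_block_same:
  assumes "A \<in> carrier_mat n n" "B \<in> carrier_mat n n" "A' \<in> carrier_mat n n" "B' \<in> carrier_mat n n"
  shows "four_block_mat A B B A + four_block_mat A' B' B' A' =
    four_block_mat (A + A') (B + B') (B + B') (A + A')"
  using assms by (intro add_four_block_mat) auto

lemma smult_four_block_same:
  assumes "A \<in> carrier_mat n n" "B \<in> carrier_mat n n"
  shows "c \<cdot>\<^sub>m four_block_mat A B B A = four_block_mat (c \<cdot>\<^sub>m A) (c \<cdot>\<^sub>m B) (c \<cdot>\<^sub>m B) (c \<cdot>\<^sub>m A)"
  using assms by (intro smult_four_block_mat) auto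

lemma zero_four_block:
  "four_block_mat (0\<^sub>m n n) (0\<^sub>m n n) (0\<^sub>m n n) (0\<^sub>m n n) = (0\<^sub>m (2 * n) (2 * n) :: complex mat)"
  by (rule eq_matI) auto

lemma bracket_diag_block:
  assumes "X \<in> carrier_mat n n" "Y \<in> carrier_mat n n"
  shows "bracket (four_block_mat X (0\<^sub>m n n) (0\<^sub>m n n) X) (four_block_mat Y (0\<^sub>m n n) (0\<^sub>m n n) Y) =
    four_block_mat (bracket X Y) (0\<^sub>m n n) (0\<^sub>m n n) (bracket X Y)"
  using assms unfolding bracket_def
  by (simp add: mult_four_block_mat[of _ n n _ n _ n _ _ n _ n] mult_square_carrier_mat)
    (intro eq_matI, auto)

lemma four_block_same_carrier:
  "X \<in> carrier_mat n n \<Longrightarrow> four_block_mat X Y Y' X \<in> carrier_mat (2 * n) (2 * n)"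
  using four_block_carrier_mat[of X n n X n n] by (simp add: mult_2)

lemma lie_algebra_g0_tilde: "lie_algebra (2 * n) (g0_tilde n)"
  unfolding lie_algebra_def mat_subspace_def g0_tilde_eq
proof (intro conjI ballI allI)
  let ?d = "\<lambda>X. four_block_mat X (0\<^sub>m n n) (0\<^sub>m n n) X :: complex mat"
  show "?d ` so_anti n \<subseteq> carrier_mat (2 * n) (2 * n)"
    by (auto simp: so_antiD four_block_same_carrier)
  show "0\<^sub>m (2 * n) (2 * n) \<in> ?d ` so_anti n"
    by (rule image_eqI[where x = "0\<^sub>m n n"]) (rule zero_four_block[symmetric] so_anti_closed(1))+
  fix Z assume "Z \<in> ?d ` so_anti n"
  then obtain X where X: "Z = ?d X" "X \<in> so_anti n" by blast
  show "c \<cdot>\<^sub>m Z \<in> ?d ` so_anti n" for c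
  proof
    show "c \<cdot>\<^sub>m Z = ?d (c \<cdot>\<^sub>m X)" using X by (simp add: smult_four_block_same[where n = n] so_antiD(1))
  qed (rule so_anti_closed(3)[OF X(2)])
  fix W assume "W \<in> ?d ` so_anti n"
  then obtain Y where Y: "W = ?d Y" "Y \<in> so_anti n" by blast
  show "Z + W \<in> ?d ` so_anti n"
  proof
    show "Z + W = ?d (X + Y)" using X Y by (simp add: add_four_block_same[where n = n] so_antiD(1))
  qed (rule so_anti_closed(2)[OF X(2) Y(2)])
  show "bracket Z W \<in> ?d ` so_anti n"
  proof
    show "bracket Z W = ?d (bracket X Y)" using X Y by (simp add: bracket_diag_block so_antiD(1))
  qed (rule so_anti_closed(4)[OF X(2) Y(2)])
qed

text \<open>Only the linear structure is transported here: the bracket of two elements of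
  \<open>V\<close> is block diagonal and thus lies in \<open>g0_tilde\<close>.\<close>

lemma mat_subspace_V: "mat_subspace (2 * n) (V n)"
  unfolding mat_subspace_def V_eq
proof (intro conjI ballI allI)
  let ?d = "\<lambda>X. four_block_mat (0\<^sub>m n n) X X (0\<^sub>m n n) :: complex mat"
  show "?d ` so_anti n \<subseteq> carrier_mat (2 * n) (2 * n)"
    by (auto simp: four_block_same_carrier)
  show "0\<^sub>m (2 * n) (2 * n) \<in> ?d ` so_anti n"
    by (rule image_eqI[where x = "0\<^sub>m n n"]) (rule zero_four_block[symmetric] so_anti_closed(1))+
  fix Z assume "Z \<in> ?d ` so_anti n"
  then obtain X where X: "Z = ?d X" "X \<in> so_anti n" by blast
  show "c \<cdot>\<^sub>m Z \<in> ?d ` so_anti n" for c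
  proof
    show "c \<cdot>\<^sub>m Z = ?d (c \<cdot>\<^sub>m X)" using X by (simp add: smult_four_block_same[where n = n] so_antiD(1))
  qed (rule so_anti_closed(3)[OF X(2)])
  fix W assume "W \<in> ?d ` so_anti n"
  then obtain Y where Y: "W = ?d Y" "Y \<in> so_anti n" by blast
  show "Z + W \<in> ?d ` so_anti n"
  proof
    show "Z + W = ?d (X + Y)" using X Y by (simp add: add_four_block_same[where n = n] so_antiD(1))
  qed (rule so_anti_closed(2)[OF X(2) Y(2)])
qed

lemma direct_sum_g0: "direct_sum (2 * n) (g0 n) (g0_tilde n) (V n)"
proof -
  have sum: "four_block_mat X (0\<^sub>m n n) (0\<^sub>m n n) X + four_block_mat (0\<^sub>m n n) Y Y (0\<^sub>m n n)
      = four_block_mat X Y Y X"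
    if "X \<in> so_anti n" "Y \<in> so_anti n" for X Y
    using that[THEN so_antiD(1)] by (simp add: add_four_block_same)
  have "g0 n = {four_block_mat X Y Y X | X Y. X \<in> so_anti n \<and> Y \<in> so_anti n}"
    by (rule g0_eq_so_anti)
  also have "\<dots> = {Z + W | Z W. Z \<in> g0_tilde n \<and> W \<in> V n}"
    unfolding g0_tilde_eq V_eq
  proof (intro equalityI subsetI)
    fix Z assume "Z \<in> {four_block_mat X Y Y X | X Y. X \<in> so_anti n \<and> Y \<in> so_anti n}"
    then show "Z \<in> {Z + W | Z W. Z \<in> (\<lambda>X. four_block_mat X (0\<^sub>m n n) (0\<^sub>m n n) X) ` so_anti n
        \<and> W \<in> (\<lambda>Y. four_block_mat (0\<^sub>m n n) Y Y (0\<^sub>m n n)) ` so_anti n}"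
      using sum by (smt (verit) imageI mem_Collect_eq)
  qed (use sum in blast)
  finally have "g0 n = {Z + W | Z W. Z \<in> g0_tilde n \<and> W \<in> V n}" .
  moreover have "g0_tilde n \<inter> V n = {0\<^sub>m (2 * n) (2 * n)}"
  proof -
    have "0\<^sub>m (2 * n) (2 * n) \<in> g0_tilde n" "0\<^sub>m (2 * n) (2 * n) \<in> V n"
      using lie_algebra_g0_tilde mat_subspace_V unfolding lie_algebra_def mat_subspace_def by blast+
    moreover have "Z = 0\<^sub>m (2 * n) (2 * n)" if "Z \<in> g0_tilde n" "Z \<in> V n" for Z
    proof -
      obtain X Y where Z: "Z = four_block_mat X (0\<^sub>m n n) (0\<^sub>m n n) X"
        and eq: "four_block_mat X (0\<^sub>m n n) (0\<^sub>m n n) X = four_block_mat (0\<^sub>m n n) Y Y (0\<^sub>m n n)"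
        and c: "X \<in> carrier_mat n n" "Y \<in> carrier_mat n n"
        using \<open>Z \<in> g0_tilde n\<close> \<open>Z \<in> V n\<close> so_antiD(1) unfolding g0_tilde_eq V_eq by blast
      have "X = 0\<^sub>m n n \<and> 0\<^sub>m n n = Y \<and> 0\<^sub>m n n = Y \<and> X = 0\<^sub>m n n"
        by (rule iffD1[OF four_block_inject[where n = n] eq]) (use c in simp_all)
      then have "X = 0\<^sub>m n n" by blast
      then show ?thesis unfolding Z by (simp only: zero_four_block)
    qed
    ultimately show ?thesis by blast
  qed
  ultimately show ?thesis
    using lie_algebra_g0_tilde mat_subspace_V unfolding direct_sum_def lie_algebra_def by blast
qed

lemma lie_isomorphic_g0_tilde: "lie_isomorphic (g0_tilde n) (so_anti n)"
proof -
  let ?d = "\<lambda>X. four_block_mat X (0\<^sub>m n n) (0\<^sub>m n n) X :: complex mat"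
  \<comment> \<open>Projection to the upper left block. It is inverse to the diagonal embedding
    \<open>?d\<close> and points in the direction needed for composing with the map to
    \<open>so n\<close>.\<close>
  define \<pi> where "\<pi> Z = fst (split_block Z n n)" for Z :: "complex mat"
  have \<pi>: "\<pi> (?d X) = X" if "X \<in> carrier_mat n n" for X
    unfolding \<pi>_def using that by (simp add: split_block_four_block)
  have "bij_betw \<pi> (g0_tilde n) (so_anti n)"
    by (rule bij_betw_byWitness[where f' = ?d]) (auto simp: g0_tilde_eq \<pi> so_antiD)
  then have "lie_iso \<pi> (g0_tilde n) (so_anti n)"
    unfolding lie_iso_def
    by (auto simp: g0_tilde_eq \<pi> so_antiD(1) so_anti_closed add_four_block_same[where n = n]
        smult_four_block_same[where n = n] bracket_diag_block)
  then show ?thesis unfolding lie_isomorphic_def by blast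
qed

theorem mainTheorem7:
  fixes n :: nat
  assumes "n \<ge> 4" and "even n"
  shows "lie_algebra (2 * n) (g n) \<and>
    lie_isomorphic (g n) (so (2 * n)) \<and>
    lie_involution (lam n) (g n) \<and>
    direct_sum (2 * n) (g n) (g0 n) (g1 n) \<and>
    (g0 n = {four_block_mat X Y Y X | X Y.
           X \<in> carrier_mat n n \<and> Y \<in> carrier_mat n n \<and>
           tilde n X = - X \<and> tilde n Y = - Y}) \<and>
    (g1 n = {four_block_mat X Y (- Y) (- X) | X Y.
           X \<in> carrier_mat n n \<and> Y \<in> carrier_mat n n \<and>
           tilde n X = X \<and> tilde n Y = - Y}) \<and>
    direct_sum (2 * n) (g0 n) (g0_tilde n) (V n) \<and>
    lie_subalgebra (2 * n) (g0_tilde n) (g0 n) \<and>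
    lie_isomorphic (g0_tilde n) (so n) \<and>
    type_D (n div 2) (g0_tilde n)"
proof -
  have inv: "lie_involution (lam n) (g n)" using assms by (intro lie_involution_lam) simp
  note eig = involution_eigenspaces[OF lie_algebra_g inv, folded g0_def g1_def]
  have "lie_isomorphic (g n) (so (2 * n))"
    unfolding g_eq_so_anti by (rule lie_isomorphic_so_anti)
  moreover have "g0_tilde n \<subseteq> g0 n" unfolding g0_tilde_def by blast
  then have "lie_subalgebra (2 * n) (g0_tilde n) (g0 n)"
    unfolding lie_subalgebra_def using eig(1) lie_algebra_g0_tilde by blast
  moreover have iso: "lie_isomorphic (g0_tilde n) (so n)"
    using lie_isomorphic_g0_tilde lie_isomorphic_so_anti by (rule lie_isomorphic_trans)
  moreover have "type_D (n div 2) (g0_tilde n)"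
    \<comment> \<open>Evenness gives \<open>2 * (n div 2) = n\<close>.\<close>
    using iso assms(2) unfolding type_D_def by simp
  ultimately show ?thesis
    using lie_algebra_g inv eig(2) g0_eq g1_eq direct_sum_g0 by blast
qed

end
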